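(* Let $\alpha=\{\alpha_1,\ldots,\alpha_p\}$ be any partition of $n$. Let $V_1=I$ and, for $t\ge 1$, let $V_{t+1}=\mathrm{chol}(X_t^\star)$, where $X_t^\star$ is the optimal solution (in the variable $X$) of the inner approximation problem $(\mathrm{In}_t)$ with matrix $V_t$, and let $\mathsf{U}_\alpha^t$ denote the optimal value of $(\mathrm{In}_t)$. Then $$\mathsf{U}^{1}_\alpha \geq \mathsf{U}^{2}_\alpha \geq \cdots \geq \mathsf{U}^{t}_\alpha \geq \mathsf{U}^{t+1}_\alpha \geq p^\star .$$
   Context: $\mathbb{S}^n$ is the set of real symmetric $n\times n$ matrices, $\mathbb{S}^n_+$ the set of positive semidefinite ones, $\langle A,B\rangle=\mathrm{tr}(AB)$ on $\mathbb{S}^n$. Problem data: $b\in\mathbb{R}^m$, $C,A_1,\ldots,A_m\in\mathbb{S}^n$. The primal and dual semidefinite programs are $$p^\star=\min_X\{\langle C,X\rangle : \langle A_i,X\rangle=b_i,\ i=1,\ldots,m,\ X\in\mathbb{S}^n_+\},$$ $$d^\star=\max_{y,Z}\{b^{\mathsf T}y : Z+\textstyle\sum_{i=1}^m A_iy_i=C,\ Z\in\mathbb{S}^n_+\},$$ and strong duality $p^\star=d^\star$ is assumed. A partition of $n$ is $\alpha=\{\alpha_1,\ldots,\alpha_p\}$ with positive integers $\alpha_i$, $\sum_{i=1}^p\alpha_i=n$. Let $E_i^\alpha=\begin{bmatrix}0&\cdots&I_{\alpha_i}&\cdots&0\end{bmatrix}\in\mathbb{R}^{\alpha_i\times n}$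 (identity in the $i$-th block position) and, for $i\neq j$, $E_{ij}^\alpha=\begin{bmatrix}E_i^\alpha \\ E_j^\alpha\end{bmatrix}\in\mathbb{R}^{(\alpha_i+\alpha_j)\times n}$. The cone of block factor-width-two matrices is $$\mathcal{FW}^n_{\alpha,2}=\Big\{\sum_{1\le k<l\le p}(E_{kl}^\alpha)^{\mathsf T}X_{kl}E_{kl}^\alpha : X_{kl}\in\mathbb{S}^{\alpha_k+\alpha_l}_+\Big\},$$ and for an $n\times n$ matrix $V$, $\mathcal{FW}^n_{\alpha,2}(V)=\{V^{\mathsf T}QV : Q\in\mathcal{FW}^n_{\alpha,2}\}$. Inner approximation problem $(\mathrm{In}_t)$ at iteration $t$, with matrix $V_t\in\mathbb{R}^{n\times n}$: $$\mathsf{U}_\alpha^t=\min_{X}\{\langle C,X\rangle:\langle A_i,X\rangle=b_i,\ i=1,\ldots,m,\ X\in\mathcal{FW}^n_{\alpha,2}(V_t)\}.$$ Equivalently, in variables $X_{kl}\in\mathbb{S}^{\alpha_k+\alpha_l}_+$, $1\le k<l\le p$: minimize $\sum_{k<l}\langle \hat C_{kl},X_{kl}\rangle$ subject to $\sum_{k<l}\langle\hat A_{i,kl},X_{kl}\rangle=b_i$ for all $i$, where $\hat C_{kl}=E_{kl}^\alpha V_tCV_t^{\mathsf T}(E_{kl}^\alpha)^{\mathsf T}$ and $\hat A_{i,kl}=E_{kl}^\alpha V_tA_iV_t^{\mathsf T}(E_{kl}^\alpha)^{\mathsf T}$; if $X_{kl}^{t,\star}$ is an optimal solution in these variables, then $X_t^\star=\sum_{k<l}V_t^{\mathsf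 T}(E_{kl}^\alpha)^{\mathsf T}X_{kl}^{t,\star}E_{kl}^\alpha V_t$. For $X\in\mathbb{S}^n_+$, $\mathrm{chol}(X)$ denotes a Cholesky factor of $X$, i.e. an upper triangular $V\in\mathbb{R}^{n\times n}$ with $X=V^{\mathsf T}V$. Standing assumption: the first problem $(\mathrm{In}_1)$ (with $V_1=I$) is feasible, and optimal solutions $X_t^\star$ of the problems $(\mathrm{In}_t)$ exist, so that the sequence $\{V_t\}$ is well defined. *)

theory Defs
  imports "Jordan_Normal_Form.Matrix" "HOL-Library.Extended_Real"
begin

definition sym_mats :: "nat \<Rightarrow> real mat set" where
  "sym_mats n = {X \<in> carrier_mat n n. transpose_mat X = X}"

definition psd_mats :: "nat \<Rightarrow> real mat set" where
  "psd_mats n = {X \<in> sym_mats n. \<forall>v \<in> carrier_vec n. v \<bullet> (X *\<^sub>v v) \<ge> 0}"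

definition mat_trace :: "real mat \<Rightarrow> real" where
  "mat_trace M = (\<Sum>i<dim_row M. M $$ (i, i))"

definition mat_inner :: "real mat \<Rightarrow> real mat \<Rightarrow> real" where
  "mat_inner M N = mat_trace (M * N)"

(* The type of matrices is not an instance of comm_monoid_add (the zero matrix depends on the
   dimensions), so finite sums of n x n matrices are taken entrywise. *)
definition mat_sum :: "nat \<Rightarrow> 'i set \<Rightarrow> ('i \<Rightarrow> real mat) \<Rightarrow> real mat" where
  "mat_sum n I F = mat n n (\<lambda>(r, c). \<Sum>i\<in>I. F i $$ (r, c))"

(* Partitions are ordered, since the order determines the block positions. *)
definition is_partition :: "nat list \<Rightarrow> nat \<Rightarrow> bool" where
  "is_partition \<alpha> n \<longleftrightarrow> (\<forall>a \<in> set \<alpha>. 0 < a) \<and> sum_list \<alpha> = n"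

(* The matrix [0 ... I ... 0] with an identity of size alpha_i in block column i; blocks are
   numbered from 0, and block i starts at column alpha_0 + ... + alpha_(i-1). *)
definition block_row :: "nat list \<Rightarrow> nat \<Rightarrow> real mat" where
  "block_row \<alpha> i = mat (\<alpha> ! i) (sum_list \<alpha>)
     (\<lambda>(r, c). if c = sum_list (take i \<alpha>) + r then 1 else 0)"

definition block_pair :: "nat list \<Rightarrow> nat \<Rightarrow> nat \<Rightarrow> real mat" where
  "block_pair \<alpha> i j = block_row \<alpha> i @\<^sub>r block_row \<alpha> j"

definition block_FW2 :: "nat list \<Rightarrow> real mat set" where
  "block_FW2 \<alpha> =
     {mat_sum (sum_list \<alpha>) {(k, l). k < l \<and> l < length \<alpha>}
        (\<lambda>(k, l). transpose_mat (block_pair \<alpha> k l) * X k l * block_pair \<alpha> k l) | X.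
      \<forall>k l. k < l \<and> l < length \<alpha> \<longrightarrow> X k l \<in> psd_mats (\<alpha> ! k + \<alpha> ! l)}"

definition block_FW2_basis :: "nat list \<Rightarrow> real mat \<Rightarrow> real mat set" where
  "block_FW2_basis \<alpha> V = {transpose_mat V * Q * V | Q. Q \<in> block_FW2 \<alpha>}"

definition feasible_in :: "real mat set \<Rightarrow> nat \<Rightarrow> (nat \<Rightarrow> real mat) \<Rightarrow> real vec \<Rightarrow> real mat set" where
  "feasible_in K m A b = {X \<in> K. \<forall>i<m. mat_inner (A i) X = b $ i}"

(* Optimal values are extended reals: an infeasible minimization has value \<infinity>, an unbounded
   one -\<infinity>; an attained minimum is the infimum. *)
definition min_value :: "real mat \<Rightarrow> real mat set \<Rightarrow> ereal" where
  "min_value C F = (INF X\<in>F. ereal (mat_inner C X))"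

definition primal_value ::
  "nat \<Rightarrow> nat \<Rightarrow> real mat \<Rightarrow> (nat \<Rightarrow> real mat) \<Rightarrow> real vec \<Rightarrow> ereal" where
  "primal_value n m C A b = min_value C (feasible_in (psd_mats n) m A b)"

definition dual_value ::
  "nat \<Rightarrow> nat \<Rightarrow> real mat \<Rightarrow> (nat \<Rightarrow> real mat) \<Rightarrow> real vec \<Rightarrow> ereal" where
  "dual_value n m C A b =
     (SUP (y, Z) \<in> {(y, Z). y \<in> carrier_vec m \<and> Z \<in> psd_mats n \<and>
                        Z + mat_sum n {..<m} (\<lambda>i. y $ i \<cdot>\<^sub>m A i) = C}.
        ereal (b \<bullet> y))"

definition inner_feasible ::
  "nat list \<Rightarrow> nat \<Rightarrow> (nat \<Rightarrow> real mat) \<Rightarrow> real vec \<Rightarrow> real mat \<Rightarrow> real mat set" where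
  "inner_feasible \<alpha> m A b V = feasible_in (block_FW2_basis \<alpha> V) m A b"

definition inner_value ::
  "nat list \<Rightarrow> nat \<Rightarrow> real mat \<Rightarrow> (nat \<Rightarrow> real mat) \<Rightarrow> real vec \<Rightarrow> real mat \<Rightarrow> ereal" where
  "inner_value \<alpha> m C A b V = min_value C (inner_feasible \<alpha> m A b V)"

definition inner_optimal ::
  "nat list \<Rightarrow> nat \<Rightarrow> real mat \<Rightarrow> (nat \<Rightarrow> real mat) \<Rightarrow> real vec \<Rightarrow> real mat \<Rightarrow> real mat \<Rightarrow> bool" where
  "inner_optimal \<alpha> m C A b V X \<longleftrightarrow>
     is_arg_min (mat_inner C) (\<lambda>Y. Y \<in> inner_feasible \<alpha> m A b V) X"

(* A relation rather than a function: Cholesky factors are not unique (no sign condition on the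
   diagonal, and X may be singular). *)
definition is_chol :: "nat \<Rightarrow> real mat \<Rightarrow> real mat \<Rightarrow> bool" where
  "is_chol n X V \<longleftrightarrow> V \<in> carrier_mat n n \<and> upper_triangular V \<and> X = transpose_mat V * V"

end

theory Submission
  imports Defs
begin

text \<open>The optimal value of a problem in the sequence is attained at \<open>X t\<close>, so for monotonicity it
  suffices that \<open>X t\<close> stays feasible in the next problem. The linear constraints are the same in
  every iteration; the question is whether \<open>X t\<close> lies in the cone transformed by its own Cholesky
  factor \<open>W = V (Suc t)\<close>. Let \<open>p\<close> be the number of blocks. If \<open>p \<ge> 2\<close>, the untransformed cone
  contains the identity (\<open>one_in_block_FW2\<close>): each block occurs in exactly \<open>p - 1\<close> pairs, so giving
  every pair the identity with weight \<open>1 / (p - 1)\<close> covers each block with total weight one. Then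
  \<open>X t = W\<^sup>T I W\<close> is the required representation.

  If \<open>p \<le> 1\<close>, there are no pairs, so the sum over pairs is empty and the cone consists of the zero
  matrix alone. This argument then breaks down, but \<open>X t\<close> is itself zero, and zero lies in every
  transformed cone. \<open>chol_in_block_FW2_basis\<close> combines the two cases.

  For the lower bound, congruences and sums preserve positive semidefiniteness, so every transformed
  cone consists of positive semidefinite matrices (\<open>block_FW2_basis_psd\<close>), and every inner problem
  minimizes over a part of the primal feasible set.\<close>

section \<open>Positive semidefinite matrices\<close>

text \<open>The quadratic form of \<open>E\<^sup>T X E\<close> at \<open>v\<close> is that of \<open>X\<close> at \<open>E v\<close>. Applied with \<open>E\<close> a selection of
  two blocks, this handles the summands of the cone; with \<open>E = V\<close>, the change of basis.\<close>

lemma psd_congruence: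
  assumes X: "X \<in> psd_mats k" and E: "E \<in> carrier_mat k n"
  shows "transpose_mat E * X * E \<in> psd_mats n"
proof -
  have Xc: "X \<in> carrier_mat k k" and Xs: "transpose_mat X = X"
    and Xp: "\<And>v. v \<in> carrier_vec k \<Longrightarrow> 0 \<le> v \<bullet> (X *\<^sub>v v)"
    using X by (auto simp: psd_mats_def sym_mats_def)
  have Et: "transpose_mat E \<in> carrier_mat n k" using E by simp
  have XE: "X * E \<in> carrier_mat k n" using Xc E by simp
  have assoc: "transpose_mat E * X * E = transpose_mat E * (X * E)"
    using Et Xc E by (rule assoc_mult_mat)
  have "transpose_mat (transpose_mat E * (X * E)) = transpose_mat (X * E) * E"
    using transpose_mult[OF Et XE] by simp
  also have "\<dots> = transpose_mat E * X * E"
    using transpose_mult[OF Xc E] Xs by simp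
  finally have sym: "transpose_mat (transpose_mat E * X * E) = transpose_mat E * X * E"
    by (simp add: assoc)
  have "0 \<le> v \<bullet> ((transpose_mat E * X * E) *\<^sub>v v)" if v: "v \<in> carrier_vec n" for v
  proof -
    have Ev: "E *\<^sub>v v \<in> carrier_vec k" using E v by simp
    have XEv: "X *\<^sub>v (E *\<^sub>v v) \<in> carrier_vec k" using Xc Ev by simp
    have "(transpose_mat E * X * E) *\<^sub>v v = transpose_mat E *\<^sub>v (X *\<^sub>v (E *\<^sub>v v))"
      using assoc_mult_mat_vec[OF Et XE v] assoc_mult_mat_vec[OF Xc E v] by (simp only: assoc)
    then have "v \<bullet> ((transpose_mat E * X * E) *\<^sub>v v) = (E *\<^sub>v v) \<bullet> (X *\<^sub>v (E *\<^sub>v v))"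
      using transpose_vec_mult_scalar[OF E v XEv]
        comm_scalar_prod[OF v, of "transpose_mat E *\<^sub>v (X *\<^sub>v (E *\<^sub>v v))"]
        comm_scalar_prod[OF Ev XEv] Et XEv by simp
    then show ?thesis using Xp[OF Ev] by simp
  qed
  then show ?thesis using sym Et Xc E unfolding psd_mats_def sym_mats_def by auto
qed

lemma psd_mat_sum:
  assumes psd: "\<And>i. i \<in> I \<Longrightarrow> F i \<in> psd_mats n"
  shows "mat_sum n I F \<in> psd_mats n"
proof -
  have c: "F i \<in> carrier_mat n n" and s: "transpose_mat (F i) = F i" if "i \<in> I" for i
    using psd[OF that] by (auto simp: psd_mats_def sym_mats_def)
  have entry: "F i $$ (r, q) = F i $$ (q, r)" if "i \<in> I" "r < n" "q < n" for i r q
    using s[OF that(1)] c[OF that(1)] that by (metis carrier_matD index_transpose_mat(1))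
  have sym: "transpose_mat (mat_sum n I F) = mat_sum n I F"
    by (rule eq_matI) (auto simp: mat_sum_def entry intro!: sum.cong)
  \<comment> \<open>Writing quadratic forms entrywise turns the statement into an exchange of finite sums, which
      suits the entrywise definition of \<open>mat_sum\<close>.\<close>
  have quad: "v \<bullet> (M *\<^sub>v v) = (\<Sum>r<n. \<Sum>q<n. v $ r * (M $$ (r, q) * v $ q))"
    if "M \<in> carrier_mat n n" "v \<in> carrier_vec n" for M :: "real mat" and v
    using that by (auto simp: scalar_prod_def sum_distrib_left atLeast0LessThan intro!: sum.cong)
  have "0 \<le> v \<bullet> (mat_sum n I F *\<^sub>v v)" if v: "v \<in> carrier_vec n" for v
  proof -
    have "v \<bullet> (mat_sum n I F *\<^sub>v v)
        = (\<Sum>r<n. \<Sum>q<n. \<Sum>i\<in>I. v $ r * (F i $$ (r, q) * v $ q))"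
      by (subst quad[OF _ v])
        (auto simp: mat_sum_def sum_distrib_left sum_distrib_right intro!: sum.cong)
    also have "\<dots> = (\<Sum>r<n. \<Sum>i\<in>I. \<Sum>q<n. v $ r * (F i $$ (r, q) * v $ q))"
      by (intro sum.cong refl sum.swap)
    also have "\<dots> = (\<Sum>i\<in>I. \<Sum>r<n. \<Sum>q<n. v $ r * (F i $$ (r, q) * v $ q))"
      by (rule sum.swap)
    also have "\<dots> = (\<Sum>i\<in>I. v \<bullet> (F i *\<^sub>v v))"
      using c v by (intro sum.cong refl) (simp add: quad)
    also have "\<dots> \<ge> 0"
      using psd v by (intro sum_nonneg) (auto simp: psd_mats_def)
    finally show ?thesis .
  qed
  then show ?thesis using sym by (auto simp: psd_mats_def sym_mats_def mat_sum_def)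
qed

lemma smult_one_psd:
  assumes "0 \<le> a"
  shows "a \<cdot>\<^sub>m 1\<^sub>m k \<in> psd_mats k"
proof -
  have "(a \<cdot>\<^sub>m 1\<^sub>m k) *\<^sub>v v = a \<cdot>\<^sub>v v" if "v \<in> carrier_vec k" for v
    using that by (intro eq_vecI) auto
  moreover have "0 \<le> v \<bullet> v" for v :: "real vec"
    by (auto simp: scalar_prod_def intro: sum_nonneg)
  ultimately have "0 \<le> v \<bullet> ((a \<cdot>\<^sub>m 1\<^sub>m k) *\<^sub>v v)" if "v \<in> carrier_vec k" for v
    using that assms by auto
  moreover have "transpose_mat (a \<cdot>\<^sub>m 1\<^sub>m k) = (a \<cdot>\<^sub>m 1\<^sub>m k :: real mat)"
    by (rule eq_matI) auto
  ultimately show ?thesis by (auto simp: psd_mats_def sym_mats_def)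
qed

section \<open>Block factor-width-two matrices\<close>

lemma block_row_carrier: "block_row \<alpha> i \<in> carrier_mat (\<alpha> ! i) (sum_list \<alpha>)"
  by (simp add: block_row_def)

lemma block_pair_carrier: "block_pair \<alpha> k l \<in> carrier_mat (\<alpha> ! k + \<alpha> ! l) (sum_list \<alpha>)"
  unfolding block_pair_def by (intro carrier_append_rows block_row_carrier)

lemma block_pair_entry:
  assumes "s < \<alpha> ! k + \<alpha> ! l" "c < sum_list \<alpha>"
  shows "block_pair \<alpha> k l $$ (s, c) =
    (if s < \<alpha> ! k then of_bool (c = sum_list (take k \<alpha>) + s)
     else of_bool (c = sum_list (take l \<alpha>) + (s - \<alpha> ! k)))"
  using assms by (simp add: block_pair_def append_rows_def block_row_def)

lemma block_FW2_psd:
  assumes "Q \<in> block_FW2 \<alpha>"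
  shows "Q \<in> psd_mats (sum_list \<alpha>)"
  using assms unfolding block_FW2_def
  by (auto intro!: psd_mat_sum psd_congruence[OF _ block_pair_carrier])

lemma block_FW2_basis_psd:
  assumes "V \<in> carrier_mat (sum_list \<alpha>) (sum_list \<alpha>)"
  shows "block_FW2_basis \<alpha> V \<subseteq> psd_mats (sum_list \<alpha>)"
  using psd_congruence[OF block_FW2_psd assms] unfolding block_FW2_basis_def by auto

lemma sum_lessThan_add:
  fixes g :: "nat \<Rightarrow> 'a::comm_monoid_add"
  shows "(\<Sum>r<a + d. g r) = (\<Sum>r<a. g r) + (\<Sum>s<d. g (a + s))"
  by (induction d) (auto simp: add.assoc)

text \<open>The block offsets cut \<open>{..<n}\<close> into consecutive intervals, one per block. Applied to the
  indicator of a diagonal entry, this says that the projections onto the blocks add up to the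
  identity.\<close>

lemma sum_over_blocks:
  fixes g :: "nat \<Rightarrow> 'a::comm_monoid_add"
  assumes "j \<le> length \<alpha>"
  shows "(\<Sum>k<j. \<Sum>s<\<alpha> ! k. g (sum_list (take k \<alpha>) + s)) = (\<Sum>r<sum_list (take j \<alpha>). g r)"
  using assms by (induction j) (auto simp: take_Suc_conv_app_nth sum_lessThan_add)

text \<open>Each of the \<open>p\<close> indices belongs to \<open>p - 1\<close> pairs. The factor is a difference of reals, so the
  identity also covers \<open>p = 0\<close>, from which the induction starts.\<close>

lemma sum_over_pairs:
  fixes f :: "nat \<Rightarrow> real"
  shows "(\<Sum>(k, l)\<in>{(k, l). k < l \<and> l < p}. f k + f l) = (real p - 1) * (\<Sum>k<p. f k)"
proof (induction p)
  case 0
  then show ?case by simp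
next
  case (Suc p)
  have split: "{(k, l). k < l \<and> l < Suc p} = {(k, l). k < l \<and> l < p} \<union> (\<lambda>k. (k, p)) ` {..<p}"
    by auto
  have fin: "finite {(k, l). k < l \<and> l < p}"
    by (rule finite_subset[of _ "{..<p} \<times> {..<p}"]) auto
  have "(\<Sum>(k, l)\<in>{(k, l). k < l \<and> l < Suc p}. f k + f l)
      = (real p - 1) * (\<Sum>k<p. f k) + (\<Sum>k<p. f k + f p)"
    unfolding split using fin Suc
    by (subst sum.union_disjoint) (auto simp: sum.reindex inj_on_def)
  also have "\<dots> = (real (Suc p) - 1) * (\<Sum>k<Suc p. f k)"
    by (simp add: sum.distrib algebra_simps)
  finally show ?case .
qed

text \<open>Here \<open>f k\<close> is the \<open>(r, c)\<close> entry of the diagonal projection onto block \<open>k\<close>. Stacking two block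
  rows adds their Gram matrices, so a multiple of the identity on a pair contributes that multiple
  of the sum of the two projections.\<close>

lemma block_pair_gram:
  assumes r: "r < sum_list \<alpha>" and c: "c < sum_list \<alpha>"
  defines "f \<equiv> \<lambda>k. \<Sum>s<\<alpha> ! k. of_bool (r = sum_list (take k \<alpha>) + s \<and> c = sum_list (take k \<alpha>) + s)"
  shows "(transpose_mat (block_pair \<alpha> k l) * (a \<cdot>\<^sub>m 1\<^sub>m (\<alpha> ! k + \<alpha> ! l)) * block_pair \<alpha> k l) $$ (r, c)
    = a * (f k + f l)"
proof -
  let ?E = "block_pair \<alpha> k l"
  have E: "?E \<in> carrier_mat (\<alpha> ! k + \<alpha> ! l) (sum_list \<alpha>)" by (rule block_pair_carrier)
  have Et: "transpose_mat ?E \<in> carrier_mat (sum_list \<alpha>) (\<alpha> ! k + \<alpha> ! l)" using E by simp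
  have "transpose_mat ?E * (a \<cdot>\<^sub>m 1\<^sub>m (\<alpha> ! k + \<alpha> ! l)) * ?E = a \<cdot>\<^sub>m (transpose_mat ?E * ?E)"
    using mult_smult_distrib[OF Et one_carrier_mat, of a] mult_smult_assoc_mat[OF Et E, of a]
      right_mult_one_mat[OF Et] by simp
  then have "(transpose_mat ?E * (a \<cdot>\<^sub>m 1\<^sub>m (\<alpha> ! k + \<alpha> ! l)) * ?E) $$ (r, c)
      = a * (\<Sum>s<\<alpha> ! k + \<alpha> ! l. ?E $$ (s, r) * ?E $$ (s, c))"
    using E r c by (auto simp: scalar_prod_def atLeast0LessThan)
  also have "(\<Sum>s<\<alpha> ! k + \<alpha> ! l. ?E $$ (s, r) * ?E $$ (s, c)) = f k + f l"
  proof -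
    have "?E $$ (s, r) * ?E $$ (s, c)
        = of_bool (r = sum_list (take k \<alpha>) + s \<and> c = sum_list (take k \<alpha>) + s)"
      if "s < \<alpha> ! k" for s
      using that r c by (simp add: block_pair_entry)
    moreover have "?E $$ (\<alpha> ! k + s, r) * ?E $$ (\<alpha> ! k + s, c)
        = of_bool (r = sum_list (take l \<alpha>) + s \<and> c = sum_list (take l \<alpha>) + s)"
      if "s < \<alpha> ! l" for s
      using that r c by (simp add: block_pair_entry)
    ultimately show ?thesis unfolding sum_lessThan_add f_def by simp
  qed
  finally show ?thesis .
qed

text \<open>The double counting at the heart of the argument: with the same weight on every pair, the sum
  over pairs is \<open>p - 1\<close> times the sum of all block projections, so the weight \<open>1 / (p - 1)\<close> yields
  the identity.\<close>

lemma one_in_block_FW2: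
  assumes p: "2 \<le> length \<alpha>"
  shows "1\<^sub>m (sum_list \<alpha>) \<in> block_FW2 \<alpha>"
proof -
  let ?p = "length \<alpha>" and ?n = "sum_list \<alpha>"
  let ?a = "1 / (real ?p - 1)"
  let ?I = "\<lambda>k l. ?a \<cdot>\<^sub>m 1\<^sub>m (\<alpha> ! k + \<alpha> ! l) :: real mat"
  let ?S = "mat_sum ?n {(k, l). k < l \<and> l < ?p}
        (\<lambda>(k, l). transpose_mat (block_pair \<alpha> k l) * ?I k l * block_pair \<alpha> k l)"
  have "1\<^sub>m ?n = ?S"
  proof (rule eq_matI)
    fix r c assume "r < dim_row ?S" "c < dim_col ?S"
    then have r: "r < ?n" and c: "c < ?n" by (auto simp: mat_sum_def)
    let ?f = "\<lambda>k. \<Sum>s<\<alpha> ! k.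
        of_bool (r = sum_list (take k \<alpha>) + s \<and> c = sum_list (take k \<alpha>) + s) :: real"
    have "?S $$ (r, c) = (\<Sum>(k, l)\<in>{(k, l). k < l \<and> l < ?p}. ?a * (?f k + ?f l))"
      using r c by (auto simp: mat_sum_def block_pair_gram intro!: sum.cong)
    also have "\<dots> = ?a * (\<Sum>(k, l)\<in>{(k, l). k < l \<and> l < ?p}. ?f k + ?f l)"
      by (simp add: sum_distrib_left case_prod_unfold)
    also have "\<dots> = (\<Sum>k<?p. ?f k)"
      unfolding sum_over_pairs using p by simp
    also have "\<dots> = (\<Sum>j<?n. of_bool (r = j \<and> c = j))"
      using sum_over_blocks[of ?p \<alpha> "\<lambda>j. of_bool (r = j \<and> c = j) :: real"] by simp
    also have "\<dots> = of_bool (r = c)"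
      using r by (cases "r = c") (auto simp: of_bool_def intro!: sum.neutral)
    finally show "1\<^sub>m ?n $$ (r, c) = ?S $$ (r, c)" using r c by simp
  qed (auto simp: mat_sum_def)
  moreover have "?I k l \<in> psd_mats (\<alpha> ! k + \<alpha> ! l)" for k l
    using p by (intro smult_one_psd) auto
  ultimately show ?thesis unfolding block_FW2_def
    by (intro CollectI exI[of _ ?I] conjI allI impI)
qed

lemma block_FW2_at_most_one_block:
  assumes "length \<alpha> \<le> 1"
  shows "block_FW2 \<alpha> = {0\<^sub>m (sum_list \<alpha>) (sum_list \<alpha>)}"
proof -
  have "mat_sum n {(k, l). k < l \<and> l < length \<alpha>} F = 0\<^sub>m n n"
    for n and F :: "nat \<times> nat \<Rightarrow> real mat"
  proof -
    have "{(k, l). k < l \<and> l < length \<alpha>} = {}" using assms by auto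
    then show ?thesis by (simp only: mat_sum_def zero_mat_def sum.empty case_prod_unfold)
  qed
  moreover have "(k < l \<and> l < length \<alpha>) = False" for k l using assms by auto
  ultimately show ?thesis unfolding block_FW2_def by (simp only: simp_thms) blast
qed

text \<open>With at least two blocks, \<open>W\<^sup>T W = W\<^sup>T I W\<close> is a representation over the cone because \<open>I\<close> lies
  in it. With at most one block, membership in the cone of the old basis \<open>V\<close> forces \<open>X = 0\<close>.\<close>

lemma chol_in_block_FW2_basis:
  assumes X: "X \<in> block_FW2_basis \<alpha> V" and V: "V \<in> carrier_mat (sum_list \<alpha>) (sum_list \<alpha>)"
    and chol: "is_chol (sum_list \<alpha>) X W"
  shows "X \<in> block_FW2_basis \<alpha> W"
proof -
  let ?n = "sum_list \<alpha>"
  have W: "W \<in> carrier_mat ?n ?n" and XW: "X = transpose_mat W * W"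
    using chol by (auto simp: is_chol_def)
  show ?thesis
  proof (cases "2 \<le> length \<alpha>")
    case True
    have "X = transpose_mat W * 1\<^sub>m ?n * W" using W XW by simp
    then show ?thesis using one_in_block_FW2[OF True] by (auto simp: block_FW2_basis_def)
  next
    case False
    have zero: "transpose_mat U * 0\<^sub>m ?n ?n * U = 0\<^sub>m ?n ?n" if "U \<in> carrier_mat ?n ?n"
      for U :: "real mat"
      using that by simp
    have "block_FW2 \<alpha> = {0\<^sub>m ?n ?n}"
      using False by (intro block_FW2_at_most_one_block) simp
    then show ?thesis using X V W zero by (auto simp: block_FW2_basis_def)
  qed
qed

section \<open>Monotonicity of the inner approximations\<close>

lemma inner_value_attained:
  assumes "inner_optimal \<alpha> m C A b V X"
  shows "inner_value \<alpha> m C A b V = ereal (mat_inner C X)"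
  unfolding inner_value_def min_value_def
  using assms unfolding inner_optimal_def is_arg_min_def
  by (intro antisym INF_lower INF_greatest) (auto simp: not_less)

theorem proposition1:
  fixes n m :: nat and \<alpha> :: "nat list"
    and C :: "real mat" and A :: "nat \<Rightarrow> real mat" and b :: "real vec"
    and V X :: "nat \<Rightarrow> real mat"
  assumes partition: "is_partition \<alpha> n"
    and b: "b \<in> carrier_vec m"
    and C: "C \<in> sym_mats n"
    and A: "\<And>i. i < m \<Longrightarrow> A i \<in> sym_mats n"
    and strong_duality: "primal_value n m C A b = dual_value n m C A b"
    and V_1: "V 1 = 1\<^sub>m n"
    and X_opt: "\<And>t. t \<ge> 1 \<Longrightarrow> inner_optimal \<alpha> m C A b (V t) (X t)"
    and V_Suc: "\<And>t. t \<ge> 1 \<Longrightarrow> is_chol n (X t) (V (Suc t))"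
  shows "\<forall>t\<ge>1. inner_value \<alpha> m C A b (V t) \<ge> inner_value \<alpha> m C A b (V (Suc t)) \<and>
               inner_value \<alpha> m C A b (V (Suc t)) \<ge> primal_value n m C A b"
proof (intro allI impI conjI)
  fix t :: nat assume t: "1 \<le> t"
  have n: "sum_list \<alpha> = n" using partition by (simp add: is_partition_def)
  have V_carrier: "V s \<in> carrier_mat n n" if "1 \<le> s" for s
  proof (cases "s = 1")
    case True
    then show ?thesis using V_1 by simp
  next
    case False
    then show ?thesis using V_Suc[of "s - 1"] that by (simp add: is_chol_def)
  qed
  have feasible: "X t \<in> inner_feasible \<alpha> m A b (V t)"
    using X_opt[OF t] by (simp add: inner_optimal_def is_arg_min_def)
  then have "X t \<in> block_FW2_basis \<alpha> (V (Suc t))"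
    using chol_in_block_FW2_basis[of "X t" \<alpha> "V t" "V (Suc t)"] V_carrier[OF t] V_Suc[OF t]
    by (simp add: n inner_feasible_def feasible_in_def)
  then have "X t \<in> inner_feasible \<alpha> m A b (V (Suc t))"
    using feasible by (simp add: inner_feasible_def feasible_in_def)
  then have "inner_value \<alpha> m C A b (V (Suc t)) \<le> ereal (mat_inner C (X t))"
    unfolding inner_value_def min_value_def by (rule INF_lower)
  then show "inner_value \<alpha> m C A b (V (Suc t)) \<le> inner_value \<alpha> m C A b (V t)"
    by (simp add: inner_value_attained[OF X_opt[OF t]])
  have "block_FW2_basis \<alpha> (V (Suc t)) \<subseteq> psd_mats n"
    using block_FW2_basis_psd[of "V (Suc t)" \<alpha>] V_carrier[of "Suc t"] by (simp add: n)
  then show "primal_value n m C A b \<le> inner_value \<alpha> m C A b (V (Suc t))"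
    unfolding primal_value_def inner_value_def min_value_def inner_feasible_def
    by (intro INF_superset_mono) (auto simp: feasible_in_def)
qed

end
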